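(* Let $G=(V,E)$ be a connected undirected graph with positive edge weights $c:E\to\mathbb{R}_+$, let $t\ge1$, and let $K$ be a set of unordered pairs of distinct vertices of $V$. Fix a total order on $V$ and write each pair in $K$ as $(u,v)$ with $u<v$. Let $E'$ be the set of directed edges obtained by replacing each $e=\{i,j\}\in E$ by the two arcs $(i,j)$ and $(j,i)$, each of weight $c_e$; for $i\in V$ let $In(i)$ and $Out(i)$ be the sets of arcs of $E'$ entering and leaving $i$. Consider the integer linear program with binary variables $x_e$ ($e\in E$) and $x^{uv}_{(i,j)}$ ($(u,v)\in K$, $(i,j)\in E'$): minimize $\sum_{e\in E}c_e x_e$ subject to (a) $\sum_{(i,j)\in E'} x^{uv}_{(i,j)}\,c_{\{i,j\}}\le t\cdot d_G(u,v)$ for all $(u,v)\in K$; (b) $\sum_{(i,j)\in Out(i)}x^{uv}_{(i,j)}-\sum_{(j,i)\in In(i)}x^{uv}_{(j,i)}$ equals $1$ if $i=u$, $-1$ if $i=v$, and $0$ otherwise, for all $(u,v)\in K$ and $i\in V$; (c) $\sum_{(i,j)\in Out(i)}x^{uv}_{(i,j)}\le 1$ for all $(u,v)\in K$ and $i\in V$; (d) $x^{uv}_{(i,j)}+x^{uv}_{(j,i)}\le x_e$ for all $(u,v)\in K$ and all $e=\{i,j\}\in E$; (e) $x_e,\,x^{uv}_{(i,j)}\in\{0,1\}$. Then for any optimal solution of this ILP, the subgraph $(V,\{e\in E: x_e=1\})$ is a minimum-cost pairwise spanner of $G$ over $K$ with stretch factor $t$ (and the optimal ILP value equals the minimum cost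 of such a spanner).
   Context: $d_G(u,v)$ is the length of a shortest $u$–$v$ path in $G$ with respect to $c$. A subgraph $H$ of $G$ is a pairwise spanner of $G$ over $K$ with stretch factor $t$ if $d_H(u,v)\le t\cdot d_G(u,v)$ for all $(u,v)\in K$; its cost is the sum of the weights of its edges. *)

theory Defs
  imports Complex_Main "HOL-Library.Extended_Real"
begin

(* A graph is a pair of a vertex set and a set of two-element vertex sets. *)
type_synonym 'a ugraph = "'a set \<times> 'a set set"

definition vertex_pairs :: "'a set \<Rightarrow> 'a set set" where
  "vertex_pairs V = {e. e \<subseteq> V \<and> card e = 2}"

definition simple_graph :: "'a ugraph \<Rightarrow> bool" where
  "simple_graph G \<longleftrightarrow> finite (fst G) \<and> snd G \<subseteq> vertex_pairs (fst G)"

definition subgraph :: "'a ugraph \<Rightarrow> 'a ugraph \<Rightarrow> bool" where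
  "subgraph H G \<longleftrightarrow> simple_graph H \<and> fst H \<subseteq> fst G \<and> snd H \<subseteq> snd G"

definition path_edges :: "'a list \<Rightarrow> 'a set list" where
  "path_edges p = map (\<lambda>(i, j). {i, j}) (zip p (tl p))"

definition is_path :: "'a ugraph \<Rightarrow> 'a \<Rightarrow> 'a list \<Rightarrow> 'a \<Rightarrow> bool" where
  "is_path G u p v \<longleftrightarrow> p \<noteq> [] \<and> hd p = u \<and> last p = v \<and> distinct p \<and>
     set p \<subseteq> fst G \<and> set (path_edges p) \<subseteq> snd G"

definition path_length :: "('a set \<Rightarrow> real) \<Rightarrow> 'a list \<Rightarrow> real" where
  "path_length c p = sum_list (map c (path_edges p))"

definition connected_graph :: "'a ugraph \<Rightarrow> bool" where
  "connected_graph G \<longleftrightarrow> (\<forall>u \<in> fst G. \<forall>v \<in> fst G. \<exists>p. is_path G u p v)"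

(* The infimum ranges over finitely many paths when G is finite; it is \<infinity> if there is none. *)
definition gdist :: "('a set \<Rightarrow> real) \<Rightarrow> 'a ugraph \<Rightarrow> 'a \<Rightarrow> 'a \<Rightarrow> ereal" where
  "gdist c G u v = (INF p \<in> {p. is_path G u p v}. ereal (path_length c p))"

definition pairwise_spanner ::
  "('a set \<Rightarrow> real) \<Rightarrow> 'a ugraph \<Rightarrow> 'a set set \<Rightarrow> real \<Rightarrow> 'a ugraph \<Rightarrow> bool" where
  "pairwise_spanner c G K t H \<longleftrightarrow> subgraph H G \<and>
     (\<forall>u v. {u, v} \<in> K \<longrightarrow> gdist c H u v \<le> ereal t * gdist c G u v)"

definition graph_cost :: "('a set \<Rightarrow> real) \<Rightarrow> 'a ugraph \<Rightarrow> real" where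
  "graph_cost c H = (\<Sum>e \<in> snd H. c e)"

definition min_cost_spanner ::
  "('a set \<Rightarrow> real) \<Rightarrow> 'a ugraph \<Rightarrow> 'a set set \<Rightarrow> real \<Rightarrow> 'a ugraph \<Rightarrow> bool" where
  "min_cost_spanner c G K t H \<longleftrightarrow> pairwise_spanner c G K t H \<and>
     (\<forall>H'. pairwise_spanner c G K t H' \<longrightarrow> graph_cost c H \<le> graph_cost c H')"

(* The pairs of K, written with the smaller vertex first; r is the reflexive order "\<le>" on V. *)
definition ordered_pairs :: "('a \<times> 'a) set \<Rightarrow> 'a set set \<Rightarrow> ('a \<times> 'a) set" where
  "ordered_pairs r K = {(u, v). {u, v} \<in> K \<and> u \<noteq> v \<and> (u, v) \<in> r}"

definition arcs :: "'a ugraph \<Rightarrow> ('a \<times> 'a) set" where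
  "arcs G = {(i, j). {i, j} \<in> snd G}"

definition In_arcs :: "'a ugraph \<Rightarrow> 'a \<Rightarrow> ('a \<times> 'a) set" where
  "In_arcs G i = {a \<in> arcs G. snd a = i}"

definition Out_arcs :: "'a ugraph \<Rightarrow> 'a \<Rightarrow> ('a \<times> 'a) set" where
  "Out_arcs G i = {a \<in> arcs G. fst a = i}"

(* y (u, v) (i, j) is the variable of arc (i, j) for the pair (u, v).  Only the values of x on
   the edges, and of y on pairs in K and arcs, are relevant. *)
definition ilp_feasible ::
  "('a set \<Rightarrow> real) \<Rightarrow> 'a ugraph \<Rightarrow> ('a \<times> 'a) set \<Rightarrow> 'a set set \<Rightarrow> real \<Rightarrow>
   ('a set \<Rightarrow> real) \<Rightarrow> ('a \<times> 'a \<Rightarrow> 'a \<times> 'a \<Rightarrow> real) \<Rightarrow> bool" where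
  "ilp_feasible c G r K t x y \<longleftrightarrow>
     (\<forall>(u, v) \<in> ordered_pairs r K.
        ereal (\<Sum>(i, j) \<in> arcs G. y (u, v) (i, j) * c {i, j}) \<le> ereal t * gdist c G u v) \<and>
     (\<forall>(u, v) \<in> ordered_pairs r K. \<forall>i \<in> fst G.
        (\<Sum>a \<in> Out_arcs G i. y (u, v) a) - (\<Sum>a \<in> In_arcs G i. y (u, v) a)
          = (if i = u then 1 else if i = v then -1 else 0)) \<and>
     (\<forall>(u, v) \<in> ordered_pairs r K. \<forall>i \<in> fst G. (\<Sum>a \<in> Out_arcs G i. y (u, v) a) \<le> 1) \<and>
     (\<forall>(u, v) \<in> ordered_pairs r K. \<forall>i j. {i, j} \<in> snd G \<longrightarrow>
        y (u, v) (i, j) + y (u, v) (j, i) \<le> x {i, j}) \<and>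
     (\<forall>e \<in> snd G. x e \<in> {0, 1}) \<and>
     (\<forall>(u, v) \<in> ordered_pairs r K. \<forall>a \<in> arcs G. y (u, v) a \<in> {0, 1})"

definition ilp_objective :: "('a set \<Rightarrow> real) \<Rightarrow> 'a ugraph \<Rightarrow> ('a set \<Rightarrow> real) \<Rightarrow> real" where
  "ilp_objective c G x = (\<Sum>e \<in> snd G. c e * x e)"

definition ilp_optimal ::
  "('a set \<Rightarrow> real) \<Rightarrow> 'a ugraph \<Rightarrow> ('a \<times> 'a) set \<Rightarrow> 'a set set \<Rightarrow> real \<Rightarrow>
   ('a set \<Rightarrow> real) \<Rightarrow> ('a \<times> 'a \<Rightarrow> 'a \<times> 'a \<Rightarrow> real) \<Rightarrow> bool" where
  "ilp_optimal c G r K t x y \<longleftrightarrow> ilp_feasible c G r K t x y \<and>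
     (\<forall>x' y'. ilp_feasible c G r K t x' y' \<longrightarrow> ilp_objective c G x \<le> ilp_objective c G x')"

end

theory Submission
  imports Defs
begin

(* Feasible points and spanners correspond to each other with equal cost.  A spanner yields a
   feasible point by taking, for each pair, the arcs of a shortest path.  Conversely, the arcs
   carrying flow connect u to v: otherwise the net flow out of the set reachable from u would be 1,
   although no unit leaves this set.  A simple path among these arcs is no longer than the total
   weight of the flow, and by (d) its edges are selected. *)

subsection \<open>Arcs of a path\<close>

text \<open>Keeps the orientation that \<open>path_edges\<close> forgets, because the flow variables
  live on arcs.\<close>

definition path_arcs :: "'a list \<Rightarrow> ('a \<times> 'a) list" where
  "path_arcs p = zip p (tl p)"

lemma path_arcs_simps [simp]:
  "path_arcs [] = []"
  "path_arcs [a] = []"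
  "path_arcs (a # b # p) = (a, b) # path_arcs (b # p)"
  by (simp_all add: path_arcs_def)

lemma path_edges_eq: "path_edges p = map (\<lambda>(i, j). {i, j}) (path_arcs p)"
  by (simp add: path_edges_def path_arcs_def)

lemma map_fst_path_arcs: "map fst (path_arcs p) = butlast p"
  by (induction p rule: induct_list012) auto

lemma map_snd_path_arcs: "map snd (path_arcs p) = tl p"
  by (induction p rule: induct_list012) auto

lemma distinct_path_arcs: "distinct p \<Longrightarrow> distinct (path_arcs p)"
  by (simp add: path_arcs_def distinct_zipI1)

text \<open>The vertex \<open>x\<close> belongs to both pieces, so no arc is lost at the cut; this
  lets a path be truncated at a given vertex.\<close>

lemma path_arcs_append:
  "path_arcs (p @ x # q) = path_arcs (p @ [x]) @ path_arcs (x # q)"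
  by (induction p rule: induct_list012) auto

lemma path_arcs_snoc:
  "p \<noteq> [] \<Longrightarrow> path_arcs (p @ [x]) = path_arcs p @ [(last p, x)]"
  by (induction p rule: induct_list012) auto

lemma path_edges_rev: "path_edges (rev p) = rev (path_edges p)"
proof (induction p rule: induct_list012)
  case (3 a b p)
  then show ?case
    using path_arcs_snoc[of "rev (b # p)" a] by (simp add: path_edges_eq insert_commute last_rev)
qed (auto simp: path_edges_eq)

lemma path_arcs_in_set: "(i, j) \<in> set (path_arcs p) \<Longrightarrow> i \<in> set p \<and> j \<in> set p"
  unfolding path_arcs_def by (metis in_set_zipE list.sel(2) list.set_sel(2))

text \<open>On a distinct list the first vertex never recurs, so no later arc reverses the first
  one. Constraint (d) relies on this: an edge used in both directions would carry 2.\<close>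

lemma path_arcs_antisym:
  "distinct p \<Longrightarrow> (i, j) \<in> set (path_arcs p) \<Longrightarrow> (j, i) \<notin> set (path_arcs p)"
  by (induction p rule: induct_list012) (auto dest: path_arcs_in_set)

text \<open>The tails of the arcs, in order, form \<open>butlast p\<close>, so distinctness makes
  \<open>fst\<close> injective on the arcs. The count is the outflow at \<open>i\<close> of the unit
  flow along \<open>p\<close>.\<close>

lemma card_path_arcs_fst:
  assumes "distinct p"
  shows "card {a \<in> set (path_arcs p). fst a = i} = of_bool (i \<in> set (butlast p))"
proof -
  have inj: "inj_on fst (set (path_arcs p))"
    using assms map_fst_path_arcs[of p] by (metis distinct_butlast distinct_map)
  have img: "set (butlast p) = fst ` set (path_arcs p)"
    by (metis map_fst_path_arcs set_map)
  have "card {a \<in> set (path_arcs p). fst a = i} = card (fst ` {a \<in> set (path_arcs p). fst a = i})"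
    by (intro card_image[symmetric] inj_on_subset[OF inj]) auto
  also have "fst ` {a \<in> set (path_arcs p). fst a = i} = (if i \<in> set (butlast p) then {i} else {})"
    unfolding img by force
  finally show ?thesis by simp
qed

lemma card_path_arcs_snd:
  assumes "distinct p"
  shows "card {a \<in> set (path_arcs p). snd a = i} = of_bool (i \<in> set (tl p))"
proof -
  have inj: "inj_on snd (set (path_arcs p))"
    using assms map_snd_path_arcs[of p] by (metis distinct_tl distinct_map)
  have img: "set (tl p) = snd ` set (path_arcs p)"
    by (metis map_snd_path_arcs set_map)
  have "card {a \<in> set (path_arcs p). snd a = i} = card (snd ` {a \<in> set (path_arcs p). snd a = i})"
    by (intro card_image[symmetric] inj_on_subset[OF inj]) auto
  also have "snd ` {a \<in> set (path_arcs p). snd a = i} = (if i \<in> set (tl p) then {i} else {})"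
    unfolding img by force
  finally show ?thesis by simp
qed

text \<open>An inner vertex lies in both \<open>butlast p\<close> and \<open>tl p\<close> and
  cancels. Since \<open>u \<noteq> v\<close>, the ends differ: \<open>u\<close> remains only in
  \<open>butlast p\<close> and \<open>v\<close> only in \<open>tl p\<close>. This yields the
  right-hand side of (b).\<close>

lemma path_divergence:
  assumes "distinct p" "hd p = u" "last p = v" "u \<noteq> v" "p \<noteq> []"
  shows "of_bool (i \<in> set (butlast p)) - of_bool (i \<in> set (tl p))
    = (if i = u then 1 else if i = v then -1 else (0::real))"
proof -
  obtain q where p: "p = u # q" using assms by (cases p) auto
  with assms obtain w where q: "q = w @ [v]" by (cases q rule: rev_cases) auto
  show ?thesis using assms(1,4) unfolding p q by (auto simp: butlast_append)
qed

lemma path_length_eq_sum_arcs: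
  "distinct p \<Longrightarrow> path_length c p = (\<Sum>(i, j) \<in> set (path_arcs p). c {i, j})"
  by (simp add: path_length_def path_edges_eq sum_list_distinct_conv_sum_set distinct_path_arcs
      case_prod_unfold comp_def)

text \<open>The path grows by one vertex per step of the closure; if that vertex was visited before,
  the path is cut back to it, which preserves distinctness.\<close>

lemma rtrancl_imp_distinct_path:
  assumes "(u, v) \<in> R\<^sup>*"
  shows "\<exists>p. p \<noteq> [] \<and> hd p = u \<and> last p = v \<and> distinct p \<and> set (path_arcs p) \<subseteq> R"
  using assms
proof (induction rule: rtrancl_induct)
  case base
  show ?case by (intro exI[of _ "[u]"]) auto
next
  case (step a b)
  then obtain p where p: "p \<noteq> []" "hd p = u" "last p = a" "distinct p" "set (path_arcs p) \<subseteq> R"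
    by blast
  show ?case
  proof (cases "b \<in> set p")
    case True
    then obtain q s where qs: "p = q @ b # s" by (meson split_list)
    show ?thesis
      using p unfolding qs path_arcs_append[of q b s]
      by (intro exI[of _ "q @ [b]"]) (auto simp: hd_append split: if_splits)
  next
    case False
    then show ?thesis
      using p step.hyps by (intro exI[of _ "p @ [b]"]) (auto simp: path_arcs_snoc)
  qed
qed

subsection \<open>Distances\<close>

lemma is_path_rev: "is_path G u p v \<Longrightarrow> is_path G v (rev p) u"
  by (auto simp: is_path_def path_edges_rev hd_rev last_rev)

lemma path_length_rev: "path_length c (rev p) = path_length c p"
  by (simp add: path_length_def path_edges_rev rev_map[symmetric])

text \<open>Reversal preserves paths and lengths. The spanner condition concerns both orders of a
  pair, whereas the program has a flow for only one of them.\<close>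

lemma gdist_commute: "gdist c G u v = gdist c G v u"
proof -
  have "gdist c G u v \<le> gdist c G v u" for u v
    unfolding gdist_def
    by (rule INF_mono) (metis is_path_rev mem_Collect_eq order_refl path_length_rev)
  then show ?thesis by (simp add: antisym)
qed

lemma gdist_le: "is_path G u p v \<Longrightarrow> gdist c G u v \<le> ereal (path_length c p)"
  unfolding gdist_def by (rule INF_lower) simp

lemma gdist_nonneg:
  assumes "\<forall>e \<in> snd G. 0 \<le> c e"
  shows "0 \<le> gdist c G u v"
  unfolding gdist_def
proof (rule INF_greatest)
  fix p assume "p \<in> {p. is_path G u p v}"
  then have "\<forall>e \<in> set (path_edges p). 0 \<le> c e"
    using assms by (auto simp: is_path_def)
  then show "0 \<le> ereal (path_length c p)"
    by (auto simp: path_length_def intro!: sum_list_nonneg)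
qed

text \<open>A finite distance excludes an empty family of paths, whose infimum is infinite. Paths
  are distinct lists over a finite set, so there are finitely many and the infimum is a
  minimum.\<close>

lemma gdist_attained:
  assumes "finite (fst G)" "gdist c G u v < \<infinity>"
  shows "\<exists>p. is_path G u p v \<and> gdist c G u v = ereal (path_length c p)"
proof -
  have ne: "{p. is_path G u p v} \<noteq> {}"
  proof
    assume "{p. is_path G u p v} = {}"
    then show False
      using assms(2) unfolding gdist_def by (simp only: image_empty Inf_empty top_ereal_def)
  qed
  have "finite {p. is_path G u p v}"
    by (rule finite_subset[OF _ finite_subset_distinct[OF assms(1)]]) (auto simp: is_path_def)
  then have "gdist c G u v \<in> (\<lambda>p. ereal (path_length c p)) ` {p. is_path G u p v}"
    unfolding gdist_def using ne by (metis Min_Inf Min_in finite_imageI image_is_empty)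
  then show ?thesis by auto
qed

lemma gdist_finite:
  assumes "connected_graph G" "u \<in> fst G" "v \<in> fst G"
  shows "gdist c G u v < \<infinity>"
proof -
  obtain p where "is_path G u p v" using assms by (auto simp: connected_graph_def)
  from gdist_le[OF this, of c] show ?thesis by auto
qed

subsection \<open>Flows\<close>

lemma finite_arcs:
  assumes "simple_graph G"
  shows "finite (arcs G)"
proof (rule finite_subset)
  show "arcs G \<subseteq> fst G \<times> fst G"
    using assms by (auto simp: arcs_def simple_graph_def vertex_pairs_def)
  show "finite (fst G \<times> fst G)" using assms by (simp add: simple_graph_def)
qed

text \<open>Arcs are grouped by tail in one double sum and by head in the other. Arcs inside
  \<open>S\<close> occur on both sides, so the difference is the net flow across the boundary of
  \<open>S\<close>.\<close>

lemma sum_net_outflow: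
  assumes "simple_graph G" "finite S"
  shows "(\<Sum>i\<in>S. (\<Sum>a\<in>Out_arcs G i. f a) - (\<Sum>a\<in>In_arcs G i. f a))
    = sum f {a \<in> arcs G. fst a \<in> S} - (sum f {a \<in> arcs G. snd a \<in> S} :: real)"
proof -
  have "(\<Sum>i\<in>S. \<Sum>a\<in>Out_arcs G i. f a)
      = (\<Sum>i\<in>S. sum f {a \<in> {a \<in> arcs G. fst a \<in> S}. fst a = i})"
    by (intro sum.cong) (auto simp: Out_arcs_def)
  also have "\<dots> = sum f {a \<in> arcs G. fst a \<in> S}"
    using finite_arcs[OF assms(1)] assms(2) by (intro sum.group) auto
  finally have out: "(\<Sum>i\<in>S. \<Sum>a\<in>Out_arcs G i. f a) = sum f {a \<in> arcs G. fst a \<in> S}" .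
  have "(\<Sum>i\<in>S. \<Sum>a\<in>In_arcs G i. f a)
      = (\<Sum>i\<in>S. sum f {a \<in> {a \<in> arcs G. snd a \<in> S}. snd a = i})"
    by (intro sum.cong) (auto simp: In_arcs_def)
  also have "\<dots> = sum f {a \<in> arcs G. snd a \<in> S}"
    using finite_arcs[OF assms(1)] assms(2) by (intro sum.group) auto
  finally show ?thesis using out by (simp add: sum_subtractf)
qed

lemma unit_flow_reaches_sink:
  fixes f :: "'a \<times> 'a \<Rightarrow> real"
  assumes G: "simple_graph G" and u: "u \<in> fst G" and nonneg: "\<forall>a \<in> arcs G. 0 \<le> f a"
    and flow: "\<forall>i \<in> fst G. (\<Sum>a \<in> Out_arcs G i. f a) - (\<Sum>a \<in> In_arcs G i. f a)
      = (if i = u then 1 else if i = v then -1 else 0)"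
  shows "(u, v) \<in> {a \<in> arcs G. f a \<noteq> 0}\<^sup>*"
proof (rule ccontr)
  define R where "R = {a \<in> arcs G. f a \<noteq> 0}"
  \<comment> \<open>Intersecting with \<open>fst G\<close> makes finiteness of \<open>S\<close>
    immediate and lets \<open>flow\<close> apply to all its members.\<close>
  define S where "S = {i \<in> fst G. (u, i) \<in> R\<^sup>*}"
  assume "(u, v) \<notin> {a \<in> arcs G. f a \<noteq> 0}\<^sup>*"
  then have v: "v \<notin> S" by (simp add: S_def R_def)
  have S: "finite S" "u \<in> S" "S \<subseteq> fst G"
    using G u by (auto simp: S_def simple_graph_def)
  have zero: "f a = 0" if "a \<in> arcs G" "fst a \<in> S" "snd a \<notin> S" for a
  proof (rule ccontr)
    assume "f a \<noteq> 0"
    then have "(fst a, snd a) \<in> R" using that by (simp add: R_def)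
    then have "(u, snd a) \<in> R\<^sup>*"
      using that(2) unfolding S_def by (blast intro: rtrancl_into_rtrancl)
    moreover have "snd a \<in> fst G"
      using G that(1) by (auto simp: arcs_def simple_graph_def vertex_pairs_def)
    ultimately show False using that by (auto simp: S_def)
  qed
  have "(1::real) = (\<Sum>i\<in>S. if i = u then 1 else 0)"
    using S by simp
  \<comment> \<open>As \<open>v\<close> is outside \<open>S\<close>, the value -1 does not occur.
    Removing \<open>right_minus_eq\<close> keeps the balance equations with value 0 in the form of a
    difference.\<close>
  also have "\<dots> = (\<Sum>i\<in>S. (\<Sum>a\<in>Out_arcs G i. f a) - (\<Sum>a\<in>In_arcs G i. f a))"
    using flow v S by (intro sum.cong) (auto simp del: right_minus_eq)
  also have "\<dots> = sum f {a \<in> arcs G. fst a \<in> S} - sum f {a \<in> arcs G. snd a \<in> S}"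
    by (rule sum_net_outflow[OF G S(1)])
  \<comment> \<open>Arcs leaving \<open>S\<close> carry nothing, so only arcs inside
    \<open>S\<close> count; they are among the arcs with head in \<open>S\<close>, whence 1 \<le>
    0.\<close>
  also have "sum f {a \<in> arcs G. fst a \<in> S} = sum f {a \<in> arcs G. fst a \<in> S \<and> snd a \<in> S}"
    using finite_arcs[OF G] zero by (intro sum.mono_neutral_right) auto
  also have "sum f {a \<in> arcs G. fst a \<in> S \<and> snd a \<in> S} \<le> sum f {a \<in> arcs G. snd a \<in> S}"
    using finite_arcs[OF G] nonneg by (intro sum_mono2) auto
  finally show False by simp
qed

subsection \<open>Feasible points and spanners\<close>

lemma ordered_pairsD:
  assumes "(u, v) \<in> ordered_pairs r K" "K \<subseteq> vertex_pairs V"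
  shows "u \<in> V" "v \<in> V" "u \<noteq> v" "{u, v} \<in> K"
  using assms by (auto simp: ordered_pairs_def vertex_pairs_def)

lemma feasible_imp_spanner:
  assumes G: "simple_graph (V, E)" and c: "\<forall>e \<in> E. 0 < c e"
    and K: "K \<subseteq> vertex_pairs V" and r: "linear_order_on V r"
    and feas: "ilp_feasible c (V, E) r K t x y"
  shows "pairwise_spanner c (V, E) K t (V, {e \<in> E. x e = 1})"
    and "graph_cost c (V, {e \<in> E. x e = 1}) = ilp_objective c (V, E) x"
proof -
  let ?H = "(V, {e \<in> E. x e = 1})"
  have x01: "x e = 0 \<or> x e = 1" if "e \<in> E" for e
    using feas that by (auto simp: ilp_feasible_def)
  have "finite E"
    using G by (auto simp: simple_graph_def vertex_pairs_def intro: finite_subset[of _ "Pow V"])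
  then have "graph_cost c ?H = (\<Sum>e\<in>E. if x e = 1 then c e else 0)"
    by (simp add: graph_cost_def sum.inter_filter)
  also have "\<dots> = ilp_objective c (V, E) x"
    unfolding ilp_objective_def using x01 by (intro sum.cong) auto
  finally show "graph_cost c ?H = ilp_objective c (V, E) x" .

  have dist: "gdist c ?H u v \<le> ereal t * gdist c (V, E) u v"
    if uv: "(u, v) \<in> ordered_pairs r K" for u v
  proof -
    let ?f = "y (u, v)"
    note uv' = ordered_pairsD[OF uv K]
    have y01: "?f a = 0 \<or> ?f a = 1" if "a \<in> arcs (V, E)" for a
      using feas uv that by (auto simp: ilp_feasible_def)
    have len: "ereal (\<Sum>(i, j) \<in> arcs (V, E). ?f (i, j) * c {i, j}) \<le> ereal t * gdist c (V, E) u v"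
      using feas uv by (auto simp: ilp_feasible_def)
    have "(u, v) \<in> {a \<in> arcs (V, E). ?f a \<noteq> 0}\<^sup>*"
      using feas uv y01
      by (intro unit_flow_reaches_sink[OF G]) (fastforce simp: ilp_feasible_def uv')+
    then obtain p where p: "p \<noteq> []" "hd p = u" "last p = v" "distinct p"
      and arcs: "set (path_arcs p) \<subseteq> {a \<in> arcs (V, E). ?f a \<noteq> 0}"
      by (blast dest: rtrancl_imp_distinct_path)
    have carry: "?f a = 1" if "a \<in> set (path_arcs p)" for a
      using that arcs y01[of a] by blast
    \<comment> \<open>The arc carries 1 and its reverse at least 0, so (d) gives
      \<open>x {i, j} \<ge> 1\<close>, and binarity forces the value 1.\<close>
    have edge: "{i, j} \<in> {e \<in> E. x e = 1}" if "(i, j) \<in> set (path_arcs p)" for i j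
    proof -
      have ij: "{i, j} \<in> E" "?f (i, j) = 1" and ji: "0 \<le> ?f (j, i)"
        using that arcs y01[of "(i, j)"] y01[of "(j, i)"]
        by (fastforce simp: arcs_def insert_commute)+
      have "?f (i, j) + ?f (j, i) \<le> x {i, j}"
        using feas uv ij(1) by (auto simp: ilp_feasible_def)
      then show ?thesis using ij ji x01[of "{i, j}"] by auto
    qed
    \<comment> \<open>Every vertex after \<open>u\<close> is the head of an arc of \<open>p\<close>,
      hence an endpoint of an edge of the graph.\<close>
    have "set p \<subseteq> V"
    proof -
      have "set p = insert u (set (tl p))" using p by (cases p) auto
      also have "set (tl p) = snd ` set (path_arcs p)" by (metis map_snd_path_arcs set_map)
      finally show ?thesis
        using uv'(1) edge G by (fastforce simp: simple_graph_def vertex_pairs_def)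
    qed
    then have "is_path ?H u p v"
      using p edge by (auto simp: is_path_def path_edges_eq)
    then have "gdist c ?H u v \<le> ereal (path_length c p)" by (rule gdist_le)
    \<comment> \<open>The flow may also use arcs off \<open>p\<close>, for instance on cycles; they
      contribute nonnegative weight, so dropping them cannot increase the sum.\<close>
    also have "path_length c p \<le> (\<Sum>(i, j) \<in> arcs (V, E). ?f (i, j) * c {i, j})"
    proof -
      have "path_length c p = (\<Sum>(i, j) \<in> set (path_arcs p). ?f (i, j) * c {i, j})"
        unfolding path_length_eq_sum_arcs[OF p(4)]
        using carry by (intro sum.cong) auto
      also have "\<dots> \<le> (\<Sum>(i, j) \<in> arcs (V, E). ?f (i, j) * c {i, j})"
      proof (rule sum_mono2)
        show "0 \<le> (case a of (i, j) \<Rightarrow> ?f (i, j) * c {i, j})"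
          if "a \<in> arcs (V, E) - set (path_arcs p)" for a
          using that y01[of a] c by (cases a) (auto simp: arcs_def less_imp_le)
      qed (use finite_arcs[OF G] arcs in auto)
      finally show ?thesis .
    qed
    also note len
    finally show ?thesis by simp
  qed
  have "gdist c ?H u v \<le> ereal t * gdist c (V, E) u v" if uv: "{u, v} \<in> K" for u v
  \<comment> \<open>Totality of \<open>r\<close> puts one of the two orders of the pair into
    \<open>ordered_pairs r K\<close>; symmetry of the distance covers the other.\<close>
  proof -
    have "u \<in> V" "v \<in> V" "u \<noteq> v" using uv K by (auto simp: vertex_pairs_def)
    then have "(u, v) \<in> r \<or> (v, u) \<in> r"
      using r by (auto simp: linear_order_on_def total_on_def)
    then have "(u, v) \<in> ordered_pairs r K \<or> (v, u) \<in> ordered_pairs r K"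
      using uv \<open>u \<noteq> v\<close> by (auto simp: ordered_pairs_def insert_commute)
    then show ?thesis using dist[of u v] dist[of v u] by (auto simp: gdist_commute[of c _ v u])
  qed
  then show "pairwise_spanner c (V, E) K t ?H"
    using G by (auto simp: pairwise_spanner_def subgraph_def simple_graph_def)
qed

text \<open>The witnesses are indicators: \<open>x\<close> of the edges of \<open>H\<close>, and
  \<open>y (u, v)\<close> of the arcs of a shortest path from \<open>u\<close> to \<open>v\<close>
  in \<open>H\<close>.\<close>

lemma spanner_imp_feasible:
  assumes G: "simple_graph (V, E)" and conn: "connected_graph (V, E)"
    and t: "1 \<le> t" and K: "K \<subseteq> vertex_pairs V"
    and H: "pairwise_spanner c (V, E) K t H"
  shows "\<exists>x y. ilp_feasible c (V, E) r K t x y \<and> ilp_objective c (V, E) x = graph_cost c H"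
proof -
  have sub: "fst H \<subseteq> V" "snd H \<subseteq> E" and finH: "finite (fst H)"
    using H by (auto simp: pairwise_spanner_def subgraph_def simple_graph_def)
  have "finite E"
    using G by (auto simp: simple_graph_def vertex_pairs_def intro: finite_subset[of _ "Pow V"])
  define x :: "'a set \<Rightarrow> real" where "x e = of_bool (e \<in> snd H)" for e
  have "\<exists>p. is_path H u p v \<and> ereal (path_length c p) \<le> ereal t * gdist c (V, E) u v"
    if uv: "(u, v) \<in> ordered_pairs r K" for u v
  proof -
    note uv' = ordered_pairsD[OF uv K]
    have le: "gdist c H u v \<le> ereal t * gdist c (V, E) u v"
      using H uv' by (auto simp: pairwise_spanner_def)
    \<comment> \<open>Connectivity of the whole graph bounds the distance in \<open>H\<close>, so a
      shortest path in \<open>H\<close> exists. In the case split, \<open>t > 0\<close> keeps a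
      factor of minus infinity from changing sign.\<close>
    also have "\<dots> < \<infinity>"
      using gdist_finite[OF conn, of u v c] uv' t by (cases "gdist c (V, E) u v") auto
    finally show ?thesis using gdist_attained[OF finH] le by metis
  qed
  then obtain P where P: "\<And>u v. (u, v) \<in> ordered_pairs r K \<Longrightarrow> is_path H u (P u v) v \<and>
      ereal (path_length c (P u v)) \<le> ereal t * gdist c (V, E) u v"
    by metis
  define y :: "'a \<times> 'a \<Rightarrow> 'a \<times> 'a \<Rightarrow> real"
    where "y = (\<lambda>(u, v) a. of_bool (a \<in> set (path_arcs (P u v))))"
  have pair: "ereal (\<Sum>(i, j) \<in> arcs (V, E). y (u, v) (i, j) * c {i, j}) \<le> ereal t * gdist c (V, E) u v
      \<and> (\<forall>i \<in> V. (\<Sum>a \<in> Out_arcs (V, E) i. y (u, v) a) - (\<Sum>a \<in> In_arcs (V, E) i. y (u, v) a)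
          = (if i = u then 1 else if i = v then -1 else 0))
      \<and> (\<forall>i \<in> V. (\<Sum>a \<in> Out_arcs (V, E) i. y (u, v) a) \<le> 1)
      \<and> (\<forall>i j. {i, j} \<in> E \<longrightarrow> y (u, v) (i, j) + y (u, v) (j, i) \<le> x {i, j})"
    if uv: "(u, v) \<in> ordered_pairs r K" for u v
  proof -
    define p where "p = P u v"
    have p: "p \<noteq> []" "hd p = u" "last p = v" "distinct p" and edges: "set (path_edges p) \<subseteq> snd H"
      and len: "ereal (path_length c p) \<le> ereal t * gdist c (V, E) u v"
      using P[OF uv] by (auto simp: is_path_def p_def)
    have y: "y (u, v) = (\<lambda>a. of_bool (a \<in> set (path_arcs p)))"
      by (simp add: y_def p_def)
    have edge: "{i, j} \<in> snd H" if "(i, j) \<in> set (path_arcs p)" for i j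
      using that edges by (force simp: path_edges_eq)
    then have sub_arcs: "set (path_arcs p) \<subseteq> arcs (V, E)"
      using sub(2) by (auto simp: arcs_def)
    have fin: "finite (Out_arcs (V, E) i)" "finite (In_arcs (V, E) i)" for i
      using finite_arcs[OF G] by (auto simp: Out_arcs_def In_arcs_def)
    have "Out_arcs (V, E) i \<inter> set (path_arcs p) = {a \<in> set (path_arcs p). fst a = i}" for i
      using sub_arcs by (auto simp: Out_arcs_def)
    then have out: "(\<Sum>a \<in> Out_arcs (V, E) i. y (u, v) a) = of_bool (i \<in> set (butlast p))" for i
      by (simp add: y fin of_bool_def sum.If_cases card_path_arcs_fst[OF p(4)])
    have "In_arcs (V, E) i \<inter> set (path_arcs p) = {a \<in> set (path_arcs p). snd a = i}" for i
      using sub_arcs by (auto simp: In_arcs_def)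
    then have inn: "(\<Sum>a \<in> In_arcs (V, E) i. y (u, v) a) = of_bool (i \<in> set (tl p))" for i
      by (simp add: y fin of_bool_def sum.If_cases card_path_arcs_snd[OF p(4)])
    have "(\<Sum>(i, j) \<in> arcs (V, E). y (u, v) (i, j) * c {i, j}) = path_length c p"
      unfolding path_length_eq_sum_arcs[OF p(4)]
      using sub_arcs finite_arcs[OF G] by (intro sum.mono_neutral_cong_right) (auto simp: y)
    \<comment> \<open>If either arc is on \<open>p\<close>, its edge is in \<open>H\<close> and the
      right side is 1, while antisymmetry keeps the left side at most 1.\<close>
    moreover have "y (u, v) (i, j) + y (u, v) (j, i) \<le> x {i, j}" for i j
      using edge[of i j] edge[of j i] path_arcs_antisym[OF p(4), of i j]
      by (auto simp: y x_def insert_commute)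
    ultimately show ?thesis
      using len path_divergence[OF p(4,2,3) ordered_pairsD(3)[OF uv K] p(1)]
      by (simp add: out inn)
  qed
  have x01: "x e = 0 \<or> x e = 1" for e by (simp add: x_def)
  have y01: "y (u, v) a = 0 \<or> y (u, v) a = 1" for u v a by (simp add: y_def)
  have "ilp_feasible c (V, E) r K t x y"
    unfolding ilp_feasible_def
    using pair by (intro conjI) (auto simp: x01 y01 simp del: right_minus_eq)
  moreover have "ilp_objective c (V, E) x = graph_cost c H"
    unfolding ilp_objective_def graph_cost_def
    using \<open>finite E\<close> sub(2) by (intro sum.mono_neutral_cong_right) (auto simp: x_def)
  ultimately show ?thesis by blast
qed

section \<open>Equality of the two optimal values\<close>

theorem theorem6:
  fixes V :: "'a set" and E :: "'a set set" and c :: "'a set \<Rightarrow> real" and t :: real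
    and K :: "'a set set" and r :: "('a \<times> 'a) set"
  assumes "simple_graph (V, E)"
    and "connected_graph (V, E)"
    and "\<forall>e \<in> E. 0 < c e"
    and "1 \<le> t"
    and "K \<subseteq> vertex_pairs V"
    and "linear_order_on V r"
  shows "(\<exists>x y. ilp_optimal c (V, E) r K t x y) \<and>
    (\<forall>x y. ilp_optimal c (V, E) r K t x y \<longrightarrow>
       min_cost_spanner c (V, E) K t (V, {e \<in> E. x e = 1}) \<and>
       ilp_objective c (V, E) x = Min {graph_cost c H | H. pairwise_spanner c (V, E) K t H})"
proof -
  let ?C = "{graph_cost c H | H. pairwise_spanner c (V, E) K t H}"
  note sp = feasible_imp_spanner[OF assms(1,3,5,6)]
  note fe = spanner_imp_feasible[OF assms(1,2,4,5)]
  have "finite E"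
    using assms(1)
    by (auto simp: simple_graph_def vertex_pairs_def intro: finite_subset[of _ "Pow V"])
  \<comment> \<open>A cost depends only on the edge set, a subset of \<open>E\<close>; thus there
    are finitely many costs and \<open>Min\<close> is meaningful once one spanner exists.\<close>
  have "?C \<subseteq> sum c ` Pow E"
    by (auto simp: graph_cost_def pairwise_spanner_def subgraph_def)
  then have finC: "finite ?C" using \<open>finite E\<close> by (meson finite_Pow_iff finite_imageI finite_subset)
  \<comment> \<open>The whole graph is a spanner: its distances are nonnegative, so multiplying by
    \<open>t \<ge> 1\<close> does not decrease them.\<close>
  have "gdist c (V, E) u v \<le> ereal t * gdist c (V, E) u v" for u v
    using gdist_nonneg[of "(V, E)" c u v] assms(3,4) ereal_mult_right_mono[of 1 "ereal t"]
    by (auto simp: less_imp_le one_ereal_def)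
  then have "pairwise_spanner c (V, E) K t (V, E)"
    using assms(1) by (simp add: pairwise_spanner_def subgraph_def)
  then have "?C \<noteq> {}" by blast
  then obtain H where H: "pairwise_spanner c (V, E) K t H" "graph_cost c H = Min ?C"
    using Min_in[OF finC] by force
  have lower: "Min ?C \<le> ilp_objective c (V, E) x" if "ilp_feasible c (V, E) r K t x y" for x y
    using sp[OF that] by (intro Min_le[OF finC]) force
  \<comment> \<open>A cheapest spanner is turned into a feasible point attaining the lower bound;
    optimal solutions therefore exist and all have this value.\<close>
  obtain x0 y0 where opt: "ilp_feasible c (V, E) r K t x0 y0" "ilp_objective c (V, E) x0 = Min ?C"
    using fe[OF H(1)] H(2) by metis
  then have "ilp_optimal c (V, E) r K t x0 y0"
    using lower by (simp add: ilp_optimal_def)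
  moreover have "min_cost_spanner c (V, E) K t (V, {e \<in> E. x e = 1}) \<and>
       ilp_objective c (V, E) x = Min ?C" if "ilp_optimal c (V, E) r K t x y" for x y
  proof -
    have feas: "ilp_feasible c (V, E) r K t x y" and "ilp_objective c (V, E) x \<le> Min ?C"
      using that opt by (auto simp: ilp_optimal_def)
    then have eq: "ilp_objective c (V, E) x = Min ?C" using lower by (simp add: antisym)
    have "Min ?C \<le> graph_cost c H'" if "pairwise_spanner c (V, E) K t H'" for H'
      using that by (intro Min_le[OF finC]) blast
    then show ?thesis using sp[OF feas] eq by (simp add: min_cost_spanner_def)
  qed
  ultimately show ?thesis by blast
qed

end
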